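(* Let $k,t$ be integers with $1\leq k\leq t$ and let $d=\binom{2t-2k}{t-k}$. Then $$bc_d(KG(2t,k))=bp_d(KG(2t,k))=\frac{1}{2}\binom{2t}{t}.$$
   Context: The Kneser graph $KG(n,r)$ has as vertices all $r$-subsets of an $n$-element set, two vertices adjacent iff the subsets are disjoint. A biclique of a graph is a complete bipartite subgraph. $bc_d(G)$ is the smallest number of bicliques of $G$ such that every edge of $G$ belongs to at least $d$ of them; $bp_d(G)$ is the smallest number of bicliques of $G$ such that every edge of $G$ belongs to exactly $d$ of them. *)

theory Defs
  imports Complex_Main "HOL-Library.Multiset"
begin

text \<open>An undirected graph is a pair of its vertex set and its edge set, an edge being the
  set of its two endpoints.\<close>

type_synonym 'a graph = "'a set \<times> 'a set set"

abbreviation verts :: "'a graph \<Rightarrow> 'a set" where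
  "verts G \<equiv> fst G"

abbreviation edges :: "'a graph \<Rightarrow> 'a set set" where
  "edges G \<equiv> snd G"

definition subgraph :: "'a graph \<Rightarrow> 'a graph \<Rightarrow> bool" where
  "subgraph H G \<longleftrightarrow> verts H \<subseteq> verts G \<and> edges H \<subseteq> edges G"

definition complete_bipartite :: "'a graph \<Rightarrow> bool" where
  "complete_bipartite H \<longleftrightarrow>
     (\<exists>X Y. X \<noteq> {} \<and> Y \<noteq> {} \<and> X \<inter> Y = {} \<and>
            verts H = X \<union> Y \<and> edges H = {{x, y} |x y. x \<in> X \<and> y \<in> Y})"

text \<open>A biclique is a subgraph, not necessarily an induced one.\<close>

definition biclique :: "'a graph \<Rightarrow> 'a graph \<Rightarrow> bool" where
  "biclique G H \<longleftrightarrow> subgraph H G \<and> complete_bipartite H"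

text \<open>Families of bicliques are multisets: a biclique may be used repeatedly, and then counts
  with its multiplicity. Without repetitions a \<open>d\<close>-fold cover need not exist (take a single
  edge and \<open>d = 2\<close>).\<close>

definition biclique_cover :: "nat \<Rightarrow> 'a graph \<Rightarrow> 'a graph multiset \<Rightarrow> bool" where
  "biclique_cover d G C \<longleftrightarrow>
     (\<forall>H \<in># C. biclique G H) \<and> (\<forall>e \<in> edges G. d \<le> size {#H \<in># C. e \<in> edges H#})"

definition biclique_partition :: "nat \<Rightarrow> 'a graph \<Rightarrow> 'a graph multiset \<Rightarrow> bool" where
  "biclique_partition d G C \<longleftrightarrow>
     (\<forall>H \<in># C. biclique G H) \<and> (\<forall>e \<in> edges G. size {#H \<in># C. e \<in> edges H#} = d)"

text \<open>For a finite simple graph both minima are attained: take every single edge \<open>d\<close> times.\<close>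

definition bc :: "nat \<Rightarrow> 'a graph \<Rightarrow> nat" where
  "bc d G = (LEAST m. \<exists>C. biclique_cover d G C \<and> size C = m)"

definition bp :: "nat \<Rightarrow> 'a graph \<Rightarrow> nat" where
  "bp d G = (LEAST m. \<exists>C. biclique_partition d G C \<and> size C = m)"

text \<open>The ground set is \<open>{0, \<dots>, n - 1}\<close>. For \<open>r \<ge> 1\<close> disjoint \<open>r\<close>-sets are distinct,
  so the graph has no loops.\<close>

definition KG :: "nat \<Rightarrow> nat \<Rightarrow> nat set graph" where
  "KG n r =
     ({A. A \<subseteq> {..<n} \<and> card A = r},
      {{A, B} |A B. A \<subseteq> {..<n} \<and> card A = r \<and> B \<subseteq> {..<n} \<and> card B = r \<and> A \<inter> B = {}})"

end

theory Submission
  imports Defs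
begin

text \<open>Two disjoint sets of vertices that are completely joined in \<open>KG (2 * t) k\<close> have disjoint
  unions, of sizes \<open>a\<close> and \<open>b\<close> with \<open>a + b \<le> 2 * t\<close>, so a biclique has at most
  \<open>(a choose k) * (b choose k) \<le> (t choose k)\<^sup>2\<close> edges. The balanced bipartitions of the ground set
  yield bicliques with exactly this number of edges, and every edge lies in exactly \<open>d\<close> of them.
  Counting pairs of an edge and a biclique containing it shows that no \<open>d\<close>-fold cover can have
  fewer members.\<close>

section \<open>Double counting\<close>

text \<open>Both sides count incidences between edges and members of \<open>C\<close>, the members
  with multiplicity. The inclusion in \<open>E\<close> ensures that no edge of a member is missed on
  the left.\<close>

lemma sum_size_filter_mset_edges:
  assumes "finite E" "\<forall>H \<in># C. edges H \<subseteq> E"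
  shows "(\<Sum>e\<in>E. size {#H \<in># C. e \<in> edges H#}) = (\<Sum>H\<in>#C. card (edges H))"
  using assms(2)
proof (induction C)
  case empty
  then show ?case by simp
next
  case (add H C)
  have "(\<Sum>e\<in>E. size {#K \<in># add_mset H C. e \<in> edges K#}) =
      (\<Sum>e\<in>E. (if e \<in> edges H then 1 else 0) + size {#K \<in># C. e \<in> edges K#})"
    by (intro sum.cong) auto
  also have "\<dots> = card (edges H \<inter> E) + (\<Sum>e\<in>E. size {#K \<in># C. e \<in> edges K#})"
    using assms(1) by (simp add: sum.distrib sum.If_cases Int_commute)
  also have "edges H \<inter> E = edges H"
    using add.prems by auto
  finally show ?case
    using add by simp
qed

lemma biclique_partition_imp_cover:
  "biclique_partition d G C \<Longrightarrow> biclique_cover d G C"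
  by (simp add: biclique_partition_def biclique_cover_def)

text \<open>The incidence count for \<open>P\<close> is \<open>size P * q\<close> and also
  \<open>d\<close> per edge. Any cover has at least as many incidences but at most \<open>q\<close>
  per member, so cancelling \<open>q > 0\<close> gives the lower bound. Partitions are covers, so
  this single bound settles both minima.\<close>

lemma bc_bp_eq_size:
  assumes fin: "finite (edges G)" and "q > 0"
    and bound: "\<And>H. biclique G H \<Longrightarrow> card (edges H) \<le> q"
    and part: "biclique_partition d G P"
    and extremal: "\<And>H. H \<in># P \<Longrightarrow> card (edges H) = q"
  shows "bc d G = size P" "bp d G = size P"
proof -
  have sub: "\<forall>H \<in># C. edges H \<subseteq> edges G" if "\<forall>H \<in># C. biclique G H" for C
    using that by (auto simp: biclique_def subgraph_def)
  have "size P * q = (\<Sum>H\<in>#P. card (edges H))"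
    by (simp add: extremal cong: image_mset_cong)
  also have "\<dots> = (\<Sum>e\<in>edges G. size {#H \<in># P. e \<in> edges H#})"
    using part sub by (subst sum_size_filter_mset_edges[OF fin]) (auto simp: biclique_partition_def)
  also have "\<dots> = card (edges G) * d"
    using part by (simp add: biclique_partition_def)
  finally have P: "size P * q = card (edges G) * d" .
  have le: "size P \<le> size C" if C: "biclique_cover d G C" for C
  proof -
    have "size P * q \<le> (\<Sum>e\<in>edges G. size {#H \<in># C. e \<in> edges H#})"
      unfolding P using C
      by (intro sum_bounded_below[where K = d, simplified]) (auto simp: biclique_cover_def)
    also have "\<dots> = (\<Sum>H\<in>#C. card (edges H))"
      using C sub by (intro sum_size_filter_mset_edges fin) (auto simp: biclique_cover_def)
    also have "\<dots> \<le> (\<Sum>H\<in>#C. q)"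
      using C bound by (intro sum_mset_mono) (auto simp: biclique_cover_def)
    finally show ?thesis using \<open>q > 0\<close> by simp
  qed
  show "bc d G = size P"
    unfolding bc_def using le part biclique_partition_imp_cover by (intro Least_equality) blast+
  show "bp d G = size P"
    unfolding bp_def using le part biclique_partition_imp_cover by (intro Least_equality) blast+
qed

section \<open>Bicliques of Kneser graphs\<close>

lemma finite_edges_KG: "finite (edges (KG n r))"
proof (rule finite_subset)
  show "edges (KG n r) \<subseteq> Pow (Pow {..<n})"
    by (auto simp: KG_def)
qed simp

text \<open>Written as falling factorials, the two sides compare factor by factor: by the AM-GM
  inequality, the product of a - i and b - i is at most the square of their mean, and the mean is at
  most t - i.\<close>

lemma binomial_mult_binomial_le:
  fixes a b t k :: nat
  assumes "a + b \<le> 2 * t"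
  shows "(a choose k) * (b choose k) \<le> (t choose k)\<^sup>2"
proof (cases "k \<le> a \<and> k \<le> b")
  case True
  \<comment> \<open>Real factors allow the midpoint of \<open>a\<close> and \<open>b\<close> to be a
    half-integer and avoid truncated subtraction.\<close>
  have choose: "real (n choose k) = (\<Prod>i<k. real n - real i) / fact k" for n
    by (simp add: binomial_gbinomial gbinomial_prod_rev atLeast0LessThan)
  have "(\<Prod>i<k. (real a - real i) * (real b - real i)) \<le> (\<Prod>i<k. (real t - real i)\<^sup>2)"
  proof (intro prod_mono conjI)
    fix i assume i: "i \<in> {..<k}"
    define x y where "x = real a - real i" and "y = real b - real i"
    have xy: "0 \<le> x" "0 \<le> y" "(x + y) / 2 \<le> real t - real i"
      using i True assms by (auto simp: x_def y_def)
    then show "0 \<le> (real a - real i) * (real b - real i)"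
      by (simp add: x_def y_def)
    have "0 \<le> (x - y)\<^sup>2" by simp
    then have "x * y \<le> ((x + y) / 2)\<^sup>2"
      by (simp add: power2_eq_square field_simps)
    also have "\<dots> \<le> (real t - real i)\<^sup>2"
      using xy by (intro power_mono) auto
    finally show "(real a - real i) * (real b - real i) \<le> (real t - real i)\<^sup>2"
      by (simp add: x_def y_def)
  qed
  then have "real (a choose k) * real (b choose k) \<le> (real (t choose k))\<^sup>2"
    by (simp add: choose prod.distrib power_divide power2_eq_square divide_right_mono)
  then show ?thesis
    by (simp flip: of_nat_mult of_nat_power)
\<comment> \<open>If \<open>k\<close> exceeds \<open>a\<close> or \<open>b\<close>, the left-hand
  side is 0.\<close>
qed (auto simp: binomial_eq_0)

text \<open>As no element lies on both sides, an unordered pair reveals which endpoint comes from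
  \<open>X\<close>.\<close>

lemma inj_on_doubleton:
  assumes "X \<inter> Y = {}"
  shows "inj_on (\<lambda>(x, y). {x, y}) (X \<times> Y)"
  using assms by (auto simp: inj_on_def doubleton_eq_iff)

lemma card_complete_bipartite_edges:
  assumes "X \<inter> Y = {}"
  shows "card {{x, y} |x y. x \<in> X \<and> y \<in> Y} = card X * card Y"
proof -
  have "{{x, y} |x y. x \<in> X \<and> y \<in> Y} = (\<lambda>(x, y). {x, y}) ` (X \<times> Y)"
    by auto
  then show ?thesis
    using card_image[OF inj_on_doubleton[OF assms]] by (simp add: card_cartesian_product)
qed

lemma card_le_choose_card_Union:
  assumes "finite (\<Union>X)" "\<And>A. A \<in> X \<Longrightarrow> card A = k"
  shows "card X \<le> card (\<Union>X) choose k"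
proof -
  have "X \<subseteq> {A. A \<subseteq> \<Union>X \<and> card A = k}"
    using assms(2) by auto
  then have "card X \<le> card {A. A \<subseteq> \<Union>X \<and> card A = k}"
    using assms(1) by (intro card_mono) auto
  then show ?thesis
    using n_subsets[OF assms(1)] by simp
qed

lemma card_edges_biclique_KG_le:
  assumes "biclique (KG (2 * t) k) H"
  shows "card (edges H) \<le> (t choose k)\<^sup>2"
proof -
  have sub: "verts H \<subseteq> verts (KG (2 * t) k)" "edges H \<subseteq> edges (KG (2 * t) k)"
    and "complete_bipartite H"
    using assms unfolding biclique_def subgraph_def by simp_all
  then obtain X Y where
    XY: "X \<inter> Y = {}" "verts H = X \<union> Y" "edges H = {{x, y} |x y. x \<in> X \<and> y \<in> Y}"
    unfolding complete_bipartite_def by (elim exE conjE)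
  have V: "A \<subseteq> {..<2 * t}" "card A = k" if "A \<in> X \<union> Y" for A
    using sub(1) XY(2) that by (auto simp: KG_def)
  have U: "\<Union>X \<subseteq> {..<2 * t}" "\<Union>Y \<subseteq> {..<2 * t}"
    using V by blast+
  then have fin: "finite (\<Union>X)" "finite (\<Union>Y)"
    using finite_subset by blast+
  have "x \<inter> y = {}" if "x \<in> X" "y \<in> Y" for x y
  proof -
    \<comment> \<open>The edge fixes its endpoints only up to order, which is harmless because
      disjointness is symmetric.\<close>
    have "{x, y} \<in> edges (KG (2 * t) k)"
      using sub(2) XY(3) that by blast
    then show ?thesis
      by (auto simp: KG_def doubleton_eq_iff)
  qed
  then have "\<Union>X \<inter> \<Union>Y = {}"
    by blast
  then have "card (\<Union>X) + card (\<Union>Y) = card (\<Union>X \<union> \<Union>Y)"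
    using fin by (simp only: card_Un_disjoint)
  also have "\<dots> \<le> 2 * t"
    using U card_mono[of "{..<2 * t}" "\<Union>X \<union> \<Union>Y"] by simp
  finally have le: "card (\<Union>X) + card (\<Union>Y) \<le> 2 * t" .
  have "card (edges H) = card X * card Y"
    using XY card_complete_bipartite_edges by simp
  also have "\<dots> \<le> (card (\<Union>X) choose k) * (card (\<Union>Y) choose k)"
    using fin V by (intro mult_mono card_le_choose_card_Union) auto
  also have "\<dots> \<le> (t choose k)\<^sup>2"
    using le by (rule binomial_mult_binomial_le)
  finally show ?thesis .
qed

section \<open>Balanced bipartitions\<close>

definition k_subsets :: "nat \<Rightarrow> 'a set \<Rightarrow> 'a set set" where
  "k_subsets k S = {A. A \<subseteq> S \<and> card A = k}"

lemma card_k_subsets: "finite S \<Longrightarrow> card (k_subsets k S) = card S choose k"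
  by (simp add: k_subsets_def n_subsets)

text \<open>For \<open>k = 0\<close> the empty set would lie in both families.\<close>

lemma k_subsets_disjoint:
  assumes "1 \<le> k" "S \<inter> T = {}"
  shows "k_subsets k S \<inter> k_subsets k T = {}"
proof -
  have False if "A \<subseteq> S" "A \<subseteq> T" "card A = k" for A
  proof -
    have "A = {}" using that assms(2) by blast
    then show False using that assms(1) by simp
  qed
  then show ?thesis by (auto simp: k_subsets_def)
qed

text \<open>For \<open>S\<close> inside the ground set, \<open>S\<close> and its complement give the
  same graph, so it really belongs to an unordered bipartition.\<close>

definition split_graph :: "nat \<Rightarrow> nat \<Rightarrow> nat set \<Rightarrow> nat set graph" where
  "split_graph n k S = (k_subsets k S \<union> k_subsets k ({..<n} - S),
     {{A, B} |A B. A \<in> k_subsets k S \<and> B \<in> k_subsets k ({..<n} - S)})"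

lemma doubleton_mem_edges_split_graph_iff:
  "{A, B} \<in> edges (split_graph n k S) \<longleftrightarrow>
    A \<in> k_subsets k S \<and> B \<in> k_subsets k ({..<n} - S) \<or>
    B \<in> k_subsets k S \<and> A \<in> k_subsets k ({..<n} - S)"
  unfolding split_graph_def snd_conv mem_Collect_eq doubleton_eq_iff by blast

lemma k_subsets_nonempty:
  assumes "k \<le> card S"
  shows "k_subsets k S \<noteq> {}"
  using assms obtain_subset_with_card_n[of k S] by (auto simp: k_subsets_def)

lemma biclique_split_graph:
  assumes "1 \<le> k" "S \<subseteq> {..<n}" "k \<le> card S" "k \<le> card ({..<n} - S)"
  shows "biclique (KG n k) (split_graph n k S)"
  unfolding biclique_def
proof
  show "subgraph (split_graph n k S) (KG n k)"
    using assms(2) unfolding subgraph_def split_graph_def KG_def k_subsets_def by auto blast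
  show "complete_bipartite (split_graph n k S)"
    unfolding complete_bipartite_def
  proof (intro exI conjI)
    show "k_subsets k S \<noteq> {}" "k_subsets k ({..<n} - S) \<noteq> {}"
      using assms by (simp_all add: k_subsets_nonempty)
    show "k_subsets k S \<inter> k_subsets k ({..<n} - S) = {}"
      using assms(1) by (intro k_subsets_disjoint) auto
  qed (simp_all add: split_graph_def)
qed

lemma card_edges_split_graph:
  assumes "1 \<le> k" "S \<subseteq> {..<n}"
  shows "card (edges (split_graph n k S)) = (card S choose k) * (card ({..<n} - S) choose k)"
proof -
  have "finite S" using assms(2) finite_subset by blast
  then show ?thesis
    using k_subsets_disjoint[OF assms(1), of S "{..<n} - S"]
    by (simp add: split_graph_def card_complete_bipartite_edges card_k_subsets)
qed

text \<open>A bipartition has two parts; requiring \<open>x \<in> S\<close> picks one of them.\<close>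

lemma card_add_card_complements:
  fixes x :: 'a
  assumes "finite N" "x \<in> N" "F \<subseteq> Pow N"
  shows "card {S \<in> F. x \<in> S} + card {S \<in> (\<lambda>S. N - S) ` F. x \<in> S} = card F"
proof -
  have fin: "finite F"
    using assms finite_subset by blast
  \<comment> \<open>Since \<open>x\<close> lies in \<open>N\<close>, a complement contains
    \<open>x\<close> exactly when the original set misses it.\<close>
  have eq: "{S \<in> (\<lambda>S. N - S) ` F. x \<in> S} = (\<lambda>S. N - S) ` {S \<in> F. x \<notin> S}"
    using assms(2) by auto
  have "inj_on (\<lambda>S. N - S) {S \<in> F. x \<notin> S}"
    using assms(3) by (intro inj_onI) blast
  then have "card {S \<in> F. x \<in> S} + card {S \<in> (\<lambda>S. N - S) ` F. x \<in> S} =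
      card {S \<in> F. x \<in> S} + card {S \<in> F. x \<notin> S}"
    unfolding eq by (simp add: card_image)
  also have "\<dots> = card ({S \<in> F. x \<in> S} \<union> {S \<in> F. x \<notin> S})"
    using fin by (intro card_Un_disjoint[symmetric]) auto
  also have "{S \<in> F. x \<in> S} \<union> {S \<in> F. x \<notin> S} = F"
    by auto
  finally show ?thesis .
qed

text \<open>Such an \<open>S\<close> consists of \<open>A\<close> and a free choice of
  \<open>t - card A\<close> points outside \<open>A\<close> and \<open>B\<close>;
  \<open>card A \<le> t\<close> makes this subtraction exact.\<close>

lemma card_separating_sets:
  assumes "finite N" "A \<subseteq> N" "B \<subseteq> N" "A \<inter> B = {}" "card A \<le> t"
  shows "card {S. S \<subseteq> N \<and> card S = t \<and> A \<subseteq> S \<and> S \<inter> B = {}} =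
    (card N - card A - card B) choose (t - card A)"
proof -
  let ?R = "N - A - B"
  have fin: "finite A" "finite B" "finite ?R"
    using assms finite_subset by blast+
  have "bij_betw (\<lambda>R. A \<union> R) {R. R \<subseteq> ?R \<and> card R = t - card A}
      {S. S \<subseteq> N \<and> card S = t \<and> A \<subseteq> S \<and> S \<inter> B = {}}"
  proof (rule bij_betw_byWitness[where f' = "\<lambda>S. S - A"])
    show "(\<lambda>R. A \<union> R) ` {R. R \<subseteq> ?R \<and> card R = t - card A}
        \<subseteq> {S. S \<subseteq> N \<and> card S = t \<and> A \<subseteq> S \<and> S \<inter> B = {}}"
    proof clarify
      fix R assume R: "R \<subseteq> ?R" "card R = t - card A"
      then have "card (A \<union> R) = card A + card R"
        using fin finite_subset by (intro card_Un_disjoint) blast+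
      then show "A \<union> R \<subseteq> N \<and> card (A \<union> R) = t \<and> A \<subseteq> A \<union> R \<and> (A \<union> R) \<inter> B = {}"
        using R assms by auto
    qed
    show "(\<lambda>S. S - A) ` {S. S \<subseteq> N \<and> card S = t \<and> A \<subseteq> S \<and> S \<inter> B = {}}
        \<subseteq> {R. R \<subseteq> ?R \<and> card R = t - card A}"
      using fin by (auto simp: card_Diff_subset)
  qed auto
  then have "card {S. S \<subseteq> N \<and> card S = t \<and> A \<subseteq> S \<and> S \<inter> B = {}} =
      card {R. R \<subseteq> ?R \<and> card R = t - card A}"
    by (simp add: bij_betw_same_card)
  also have "\<dots> = card ?R choose (t - card A)"
    using fin(3) by (rule n_subsets)
  also have "card ?R = card N - card A - card B"
  proof -
    have "card ?R = card (N - A) - card B"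
      using fin assms by (intro card_Diff_subset) auto
    then show ?thesis using fin assms by (simp add: card_Diff_subset)
  qed
  finally show ?thesis .
qed

section \<open>Half-sized subsets of the ground set under complementation\<close>

definition halves :: "nat \<Rightarrow> nat set set" where
  "halves t = {S. S \<subseteq> {..<2 * t} \<and> card S = t}"

lemma finite_halves: "finite (halves t)"
  by (simp add: halves_def)

lemma card_Diff_half:
  assumes "S \<in> halves t"
  shows "card ({..<2 * t} - S) = t"
proof -
  have "finite S" using assms finite_subset by (auto simp: halves_def)
  then show ?thesis using assms by (auto simp: halves_def card_Diff_subset)
qed

text \<open>Complementation is an involution on \<open>halves t\<close>. With trivial predicates
  this says that \<open>halves t\<close> is closed under it; with other predicates it exchanges the
  two ways in which a half can split a given edge.\<close>

lemma image_complement_halves: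
  assumes "\<And>S. S \<subseteq> {..<2 * t} \<Longrightarrow> Q ({..<2 * t} - S) \<longleftrightarrow> P S"
  shows "(\<lambda>S. {..<2 * t} - S) ` {S \<in> halves t. P S} = {S \<in> halves t. Q S}"
proof (intro equalityI subsetI)
  fix T assume "T \<in> (\<lambda>S. {..<2 * t} - S) ` {S \<in> halves t. P S}"
  then obtain S where "T = {..<2 * t} - S" "S \<in> halves t" "P S" by blast
  then show "T \<in> {S \<in> halves t. Q S}"
    using card_Diff_half[of S t] assms by (auto simp: halves_def)
next
  fix T assume T: "T \<in> {S \<in> halves t. Q S}"
  then have sub: "T \<subseteq> {..<2 * t}" by (auto simp: halves_def)
  then have T_eq: "T = {..<2 * t} - ({..<2 * t} - T)" by blast
  have "{..<2 * t} - T \<in> {S \<in> halves t. P S}"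
    using T card_Diff_half[of T t] assms[of "{..<2 * t} - T"] T_eq by (auto simp: halves_def)
  then show "T \<in> (\<lambda>S. {..<2 * t} - S) ` {S \<in> halves t. P S}"
    using T_eq by blast
qed

text \<open>Complementation pairs up the halves, and exactly one of each pair contains 0;
  \<open>1 \<le> t\<close> puts 0 into the ground set.\<close>

lemma card_halves_containing_0:
  assumes "1 \<le> t"
  shows "2 * card {S \<in> halves t. 0 \<in> S} = (2 * t) choose t"
proof -
  have "card {S \<in> halves t. 0 \<in> S} + card {S \<in> (\<lambda>S. {..<2 * t} - S) ` halves t. 0 \<in> S}
      = card (halves t)"
    using assms by (intro card_add_card_complements) (auto simp: halves_def)
  moreover have "(\<lambda>S. {..<2 * t} - S) ` halves t = halves t"
    using image_complement_halves[of t "\<lambda>_. True" "\<lambda>_. True"] by simp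
  moreover have "card (halves t) = (2 * t) choose t"
    by (simp add: halves_def n_subsets)
  ultimately show ?thesis by simp
qed

text \<open>A half splits the edge {A, B} by containing \<open>A\<close> and missing
  \<open>B\<close>, or the other way round. Complements exchange these two families, so keeping only
  the halves with 0 leaves as many sets as one whole family has.\<close>

lemma card_halves_splitting_edge:
  assumes "1 \<le> k" "k \<le> t" "e \<in> edges (KG (2 * t) k)"
  shows "card {S \<in> halves t. 0 \<in> S \<and> e \<in> edges (split_graph (2 * t) k S)} =
    (2 * t - 2 * k) choose (t - k)"
proof -
  let ?N = "{..<2 * t}"
  obtain A B where e: "e = {A, B}" and A: "A \<subseteq> ?N" "card A = k" and B: "B \<subseteq> ?N" "card B = k"
    and AB: "A \<inter> B = {}"
    using assms(3) by (auto simp: KG_def)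
  define F where "F = {S \<in> halves t. A \<subseteq> S \<and> S \<inter> B = {}}"
  define F' where "F' = {S \<in> halves t. B \<subseteq> S \<and> S \<inter> A = {}}"
  have split: "e \<in> edges (split_graph (2 * t) k S) \<longleftrightarrow> S \<in> F \<or> S \<in> F'" if "S \<in> halves t" for S
    using that A B by (auto simp: F_def F'_def e doubleton_mem_edges_split_graph_iff k_subsets_def)
  \<comment> \<open>A set in both families would contain the nonempty \<open>A\<close> and also be
    disjoint from it.\<close>
  have disj: "F \<inter> F' = {}"
  proof -
    have "A \<noteq> {}" using A assms(1) by auto
    then show ?thesis by (auto simp: F_def F'_def)
  qed
  have fin: "finite F" "finite F'"
    using finite_halves by (simp_all add: F_def F'_def)
  have F': "F' = (\<lambda>S. ?N - S) ` F"
    unfolding F_def F'_def using A B by (intro image_complement_halves[symmetric]) blast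
  have "{S \<in> halves t. 0 \<in> S \<and> e \<in> edges (split_graph (2 * t) k S)} =
      {S \<in> F. 0 \<in> S} \<union> {S \<in> F'. 0 \<in> S}"
    using split by (auto simp: F_def F'_def)
  then have "card {S \<in> halves t. 0 \<in> S \<and> e \<in> edges (split_graph (2 * t) k S)} =
      card {S \<in> F. 0 \<in> S} + card {S \<in> F'. 0 \<in> S}"
    using fin disj by (simp add: card_Un_disjoint disjoint_iff)
  also have "\<dots> = card F"
    unfolding F' using assms by (intro card_add_card_complements) (auto simp: F_def halves_def)
  also have "F = {S. S \<subseteq> ?N \<and> card S = t \<and> A \<subseteq> S \<and> S \<inter> B = {}}"
    by (auto simp: F_def halves_def)
  also have "card \<dots> = (2 * t - 2 * k) choose (t - k)"
    using card_separating_sets[of ?N A B t] A B AB assms by (simp add: mult_2)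
  finally show ?thesis .
qed

theorem theorem2p3:
  fixes k t d :: nat
  assumes "1 \<le> k" and "k \<le> t"
    and "d = (2 * t - 2 * k) choose (t - k)"
  shows "bc d (KG (2 * t) k) = bp d (KG (2 * t) k) \<and>
         real (bp d (KG (2 * t) k)) = 1 / 2 * real ((2 * t) choose t)"
proof -
  \<comment> \<open>Requiring 0 in \<open>S\<close> takes each balanced bipartition once rather than
    twice.\<close>
  define C where "C = image_mset (split_graph (2 * t) k) (mset_set {S \<in> halves t. 0 \<in> S})"
  have memC: "\<exists>S \<in> halves t. H = split_graph (2 * t) k S" if "H \<in># C" for H
    using that finite_halves by (auto simp: C_def)
  have card_edges: "card (edges H) = (t choose k)\<^sup>2" if "H \<in># C" for H
    using memC[OF that] assms(1) card_Diff_half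
    by (auto simp: card_edges_split_graph halves_def power2_eq_square)
  have part: "biclique_partition d (KG (2 * t) k) C"
    unfolding biclique_partition_def
  proof (intro conjI ballI)
    fix H assume "H \<in># C"
    then obtain S where "S \<in> halves t" "H = split_graph (2 * t) k S"
      using memC by blast
    then show "biclique (KG (2 * t) k) H"
      using assms card_Diff_half[of S t] by (auto simp: halves_def intro!: biclique_split_graph)
  next
    fix e assume "e \<in> edges (KG (2 * t) k)"
    then show "size {#H \<in># C. e \<in> edges H#} = d"
      using card_halves_splitting_edge[of k t e] assms finite_halves
      by (simp add: C_def filter_mset_image_mset filter_mset_mset_set conj_assoc)
  qed
  \<comment> \<open>The premise left open is positivity of \<open>(t choose k)\<^sup>2\<close>,
    which follows from \<open>k \<le> t\<close>.\<close>
  have "bc d (KG (2 * t) k) = size C" "bp d (KG (2 * t) k) = size C"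
    using bc_bp_eq_size[OF finite_edges_KG _ card_edges_biclique_KG_le part card_edges] assms(2)
    by simp_all
  moreover have "2 * size C = (2 * t) choose t"
    using card_halves_containing_0[of t] assms by (simp add: C_def)
  ultimately show ?thesis
    by (simp flip: of_nat_mult)
qed

end
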